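(* Let $\mathcal D$ be the conflict digraph of a successive index coding (SIC) problem. An arc $e$ of $\mathcal D$ is critical if it belongs to one of the following: (a) the unique shortest chordless dicycle of $\mathcal D$ (i.e. there is a single chordless dicycle of minimum length), when the dicycle-vertex incidence matrix of $\mathcal D$ is ideal; (b) the unique largest clique of $\mathcal D$ (i.e. there is a single clique of maximum size), when $\mathcal D$ is a perfect digraph.
   Context: SIC problem. Let $\mathcal D=(\mathcal V,\mathcal A)$ be a finite digraph (conflict digraph) on $\mathcal V=\{1,\dots,n\}$. A transmitter holds messages $x_1,\dots,x_n$ with $x_i\in\{0,1\}^{t_i}$ and broadcasts a word in $\{0,1\}^r$ noiselessly to receivers $1,\dots,n$; receiver $j$ wants $x_j$ and initially knows $x_i$ for $i\in\mathcal S_j=\{i\ne j:(i,j)\notin\mathcal A\}$. Given a decoding order $\pi$ (a strict partial order $\prec_\pi$ on $\mathcal V$), receiver $j$ also gets $x_i$ for all $i\prec_\pi j$, so it knows $x(\mathcal S_j^\pi)$ with $\mathcal S_j^\pi=\mathcal S_j\cup\{i:i\prec_\pi j\}$. A code consists of an encoder $\phi:\prod_i\{0,1\}^{t_i}\to\{0,1\}^r$ and decoders $\psi_j^\pi$ with $\psi_j^\pi(\phi(x^n),x(\mathcal S_j^\pi))=x_j$ for all $j$ and all message tuples; $\mathcal R^\pi$ is the set of $(R_1,\dots,R_n)$ with $R_j\le t_j/r$ for all $j$ for some such code. The capacity region is $\mathscr C=\mathrm{conv}(\bigcup_\pi\mathcal R^\pi)$ and the broadcast rate is $\beta^{\rm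 SIC}(\mathcal D)=\inf\{b:(1/b,\dots,1/b)\in\mathscr C\}$. An arc $e$ of $\mathcal D$ is critical if $\beta^{\rm SIC}(\mathcal D-e)<\beta^{\rm SIC}(\mathcal D)$, where $\mathcal D-e$ is $\mathcal D$ with the arc $e$ removed. A dicycle is a directed cycle of length at least 2; it is chordless if its vertices induce no further arcs. A clique is a vertex set with both arcs between any two distinct members. The dicycle-vertex incidence matrix $\boldsymbol B$ of $\mathcal D$ has as rows the incidence vectors of the chordless dicycles; it is ideal if $\{y\in[0,1]^n:\boldsymbol By\ge\mathbf 1\}$ has only integral extreme points. A digraph $\mathcal D$ is perfect if for every induced sub-digraph the dichromatic number (minimum number of sets in a partition of the vertices into sets inducing acyclic sub-digraphs) equals the size of its largest clique. *)

theory Defs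
  imports
    "Graph_Theory.Digraph_Component"
    "HOL-Library.Disjoint_Sets"
    "HOL-Analysis.Analysis"
begin

section \<open>Successive index coding\<close>

text \<open>
  Messages, receivers and the vertices of the conflict digraph are all indexed by the finite
  type \<open>'n\<close>; the definitions of this section are meant for digraphs whose vertex set is
  the whole type.
\<close>

definition side_info :: "('n, 'b) pre_digraph \<Rightarrow> 'n \<Rightarrow> 'n set" where
  "side_info D j = {i. i \<noteq> j \<and> \<not> (i \<rightarrow>\<^bsub>D\<^esub> j)}"

definition decoding_order :: "'n rel \<Rightarrow> bool" where
  "decoding_order P \<longleftrightarrow> irrefl P \<and> trans P"

definition side_info_ord :: "('n, 'b) pre_digraph \<Rightarrow> 'n rel \<Rightarrow> 'n \<Rightarrow> 'n set" where
  "side_info_ord D P j = side_info D j \<union> {i. (i, j) \<in> P}"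

definition words :: "nat \<Rightarrow> bool list set" where
  "words k = {w. length w = k}"

definition messages :: "('n \<Rightarrow> nat) \<Rightarrow> ('n \<Rightarrow> bool list) set" where
  "messages t = (\<Pi> i\<in>UNIV. words (t i))"

text \<open>
  The second argument of a decoder is the message tuple with every entry outside the known
  index set replaced by \<open>undefined\<close>.
\<close>

definition sic_code ::
  "('n, 'b) pre_digraph \<Rightarrow> 'n rel \<Rightarrow> ('n \<Rightarrow> nat) \<Rightarrow> nat \<Rightarrow>
   (('n \<Rightarrow> bool list) \<Rightarrow> bool list) \<Rightarrow>
   ('n \<Rightarrow> bool list \<Rightarrow> ('n \<Rightarrow> bool list) \<Rightarrow> bool list) \<Rightarrow> bool"
where
  "sic_code D P t r \<phi> \<psi> \<longleftrightarrow>
     \<phi> \<in> messages t \<rightarrow> words r \<and>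
     (\<forall>j. \<forall>x\<in>messages t. \<psi> j (\<phi> x) (restrict x (side_info_ord D P j)) = x j)"

definition rate_region :: "('n::finite, 'b) pre_digraph \<Rightarrow> 'n rel \<Rightarrow> (real ^ 'n) set" where
  "rate_region D P =
     {R. \<exists>t r \<phi> \<psi>. 0 < r \<and> sic_code D P t r \<phi> \<psi> \<and>
                   (\<forall>j. 0 \<le> R $ j \<and> R $ j \<le> real (t j) / real r)}"

definition capacity_region :: "('n::finite, 'b) pre_digraph \<Rightarrow> (real ^ 'n) set" where
  "capacity_region D = convex hull (\<Union>P\<in>{P. decoding_order P}. rate_region D P)"

text \<open>The condition \<open>0 < b\<close> excludes the value \<open>1 / 0 = 0\<close>.\<close>

definition broadcast_rate :: "('n::finite, 'b) pre_digraph \<Rightarrow> real" where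
  "broadcast_rate D = Inf {b. 0 < b \<and> (\<chi> j. 1 / b) \<in> capacity_region D}"

definition critical_arc :: "('n::finite, 'b) pre_digraph \<Rightarrow> 'b \<Rightarrow> bool" where
  "critical_arc D e \<longleftrightarrow>
     e \<in> arcs D \<and> broadcast_rate (pre_digraph.del_arc D e) < broadcast_rate D"


section \<open>Chordless dicycles and ideal matrices\<close>

text \<open>
  A dicycle is represented by its set of arcs, so that rotations of the same closed walk are
  identified and the length is the cardinality.
\<close>

definition dicycles :: "('a, 'b) pre_digraph \<Rightarrow> 'b set set" where
  "dicycles D = {set p | p. pre_digraph.cycle D p \<and> 2 \<le> length p}"

definition dicycle_verts :: "('a, 'b) pre_digraph \<Rightarrow> 'b set \<Rightarrow> 'a set" where
  "dicycle_verts D C = tail D ` C"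

definition chordless_dicycles :: "('a, 'b) pre_digraph \<Rightarrow> 'b set set" where
  "chordless_dicycles D = {C \<in> dicycles D. arcs (D \<restriction> dicycle_verts D C) \<subseteq> C}"

definition shortest_chordless_dicycles :: "('a, 'b) pre_digraph \<Rightarrow> 'b set set" where
  "shortest_chordless_dicycles D =
     {C \<in> chordless_dicycles D. \<forall>C'\<in>chordless_dicycles D. card C \<le> card C'}"

text \<open>A matrix enters only through its set of rows.\<close>

definition dicycle_vertex_incidence :: "('n::finite, 'b) pre_digraph \<Rightarrow> (real ^ 'n) set" where
  "dicycle_vertex_incidence D =
     (\<lambda>C. \<chi> v. of_bool (v \<in> dicycle_verts D C)) ` chordless_dicycles D"

definition covering_polytope :: "(real ^ 'n::finite) set \<Rightarrow> (real ^ 'n) set" where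
  "covering_polytope B = {y. (\<forall>v. 0 \<le> y $ v \<and> y $ v \<le> 1) \<and> (\<forall>b\<in>B. 1 \<le> b \<bullet> y)}"

definition ideal_matrix :: "(real ^ 'n::finite) set \<Rightarrow> bool" where
  "ideal_matrix B \<longleftrightarrow> (\<forall>y. y extreme_point_of covering_polytope B \<longrightarrow> (\<forall>v. y $ v \<in> \<int>))"


section \<open>Cliques and perfect digraphs\<close>

definition cliques :: "('a, 'b) pre_digraph \<Rightarrow> 'a set set" where
  "cliques D = {K. K \<subseteq> verts D \<and> (\<forall>u\<in>K. \<forall>v\<in>K. u \<noteq> v \<longrightarrow> u \<rightarrow>\<^bsub>D\<^esub> v)}"

definition largest_cliques :: "('a, 'b) pre_digraph \<Rightarrow> 'a set set" where
  "largest_cliques D = {K \<in> cliques D. \<forall>K'\<in>cliques D. card K' \<le> card K}"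

definition clique_number :: "('a, 'b) pre_digraph \<Rightarrow> nat" where
  "clique_number D = Max (card ` cliques D)"

definition acyclic_digraph :: "('a, 'b) pre_digraph \<Rightarrow> bool" where
  "acyclic_digraph D \<longleftrightarrow> \<not> (\<exists>p. pre_digraph.cycle D p)"

definition dichromatic_number :: "('a, 'b) pre_digraph \<Rightarrow> nat" where
  "dichromatic_number D =
     (LEAST k. \<exists>P. partition_on (verts D) P \<and> card P = k \<and> (\<forall>W\<in>P. acyclic_digraph (D \<restriction> W)))"

definition perfect_digraph :: "('a, 'b) pre_digraph \<Rightarrow> bool" where
  "perfect_digraph D \<longleftrightarrow>
     (\<forall>W. W \<subseteq> verts D \<longrightarrow> dichromatic_number (D \<restriction> W) = clique_number (D \<restriction> W))"

end

theory Submission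
  imports Defs
begin

text \<open>
  In any decoding order some vertex of a dicycle (of a clique) comes first, which bounds the rates:
  their sum is at most \<open>|C| - 1\<close> over a dicycle \<open>C\<close> and at most \<open>1\<close> over a clique. Conversely, a vertex
  set inducing an acyclic sub-digraph can be served in a single channel use, so fractional coverings
  by such sets bound the broadcast rate from above.

  If \<open>D\<close> is perfect with unique largest clique \<open>K\<close> of size \<open>\<omega>\<close> and \<open>e\<close> joins \<open>u\<close> to \<open>v\<close> in \<open>K\<close>, then
  \<open>D - u\<close> and \<open>D - v\<close> are each covered by \<open>\<omega> - 1\<close> acyclic sets. Together with \<open>{u, v}\<close>, acyclic in
  \<open>D - e\<close>, at most \<open>2\<omega> - 1\<close> sets cover every vertex twice, so the rate drops to at most \<open>\<omega> - 1/2\<close>.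

  If the incidence matrix is ideal and \<open>C\<close> is the unique shortest chordless dicycle, of length \<open>k\<close>,
  the vector with entries \<open>1/k\<close> on \<open>C\<close> and \<open>1/(k+1)\<close> elsewhere is a convex combination of vertex sets
  meeting every chordless dicycle, whose complements are acyclic. There is slack off \<open>C\<close>, and mixing
  in the vertex set of \<open>C\<close>, acyclic in \<open>D - e\<close>, raises the rates on \<open>C\<close> too, so that the uniform rate
  exceeds \<open>(k - 1)/k\<close>.
\<close>

subsection \<open>Cycles as arc lists\<close>

text \<open>Replaces the recursion along a walk by one equation between lists: each arc starts where
  the preceding one ends. For a closed walk this says that the heads are the tails rotated by one
  place.\<close>

lemma (in pre_digraph) cas_iff: "cas u p v \<longleftrightarrow> u # map (head G) p = map (tail G) p @ [v]"
  by (induction u p v rule: cas.induct) auto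

text \<open>Written in terms of heads, tails and \<open>arcs G\<close> alone, being a cycle
  transfers at once to induced sub-digraphs and to the deletion of an arc, and is visibly invariant
  under rotation.\<close>

lemma (in wf_digraph) cycle_iff_rotate1:
  "cycle p \<longleftrightarrow> p \<noteq> [] \<and> set p \<subseteq> arcs G \<and> distinct (map (tail G) p) \<and>
     map (head G) p = rotate1 (map (tail G) p)"
proof (cases p)
  case (Cons f q)
  have verts: "awalk_verts u p = tail G f # map (head G) p" if "cas u p u" for u
    using awalk_verts_conv'[OF that] Cons by simp
  have "tail G f \<in> verts G" if "f \<in> arcs G"
    using that by simp
  moreover have "distinct (map (head G) p) \<longleftrightarrow> distinct (map (tail G) p)"
    if "map (head G) p = rotate1 (map (tail G) p)"
    unfolding that by simp
  moreover have "cas u p u \<longleftrightarrow> u = tail G f \<and> map (head G) p = rotate1 (map (tail G) p)" for u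
    unfolding cas_iff Cons by auto
  ultimately show ?thesis
    unfolding cycle_def awalk_def using verts Cons by (metis list.sel(3) list.distinct(1) list.set_intros(1) subsetD)
qed (simp add: cycle_def)

lemma (in wf_digraph) cycle_induce_subgraph:
  "pre_digraph.cycle (G \<restriction> W) p \<longleftrightarrow> cycle p \<and> tail G ` set p \<subseteq> W"
proof -
  interpret H: wf_digraph "G \<restriction> W" ..
  \<comment> \<open>A rotation keeps the set of entries, so confining the tails to \<open>W\<close>
    confines the heads as well.\<close>
  have "head G ` set p = tail G ` set p" if "map (head G) p = rotate1 (map (tail G) p)"
    using arg_cong[OF that, of set] by simp
  then show ?thesis
    unfolding H.cycle_iff_rotate1 cycle_iff_rotate1 by (fastforce simp: subset_iff)
qed

lemma (in wf_digraph) cycle_del_arc: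
  "pre_digraph.cycle (del_arc e) p \<longleftrightarrow> cycle p \<and> e \<notin> set p"
proof -
  interpret H: wf_digraph "del_arc e" by (rule wf_digraph_del_arc)
  show ?thesis
    unfolding H.cycle_iff_rotate1 cycle_iff_rotate1 by auto
qed

lemma (in wf_digraph) cycle_rotateE:
  assumes "cycle p" and "f \<in> set p"
  obtains q where "cycle (f # q)" and "set (f # q) = set p" and "length (f # q) = length p"
proof -
  obtain xs ys where p: "p = xs @ f # ys"
    using split_list[OF assms(2)] by blast
  have rot: "rotate (length xs) p = f # ys @ xs"
    unfolding p by (simp add: rotate_append)
  have "cycle (rotate (length xs) p)"
    using assms(1) unfolding cycle_iff_rotate1
    by (auto simp flip: rotate_map simp: rotate1_rotate_swap)
  then show thesis
    using that[of "ys @ xs"] unfolding rot by (auto simp: p)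
qed

section \<open>Dicycles as arc sets, and chordless dicycles\<close>

lemma dicycleE:
  assumes "wf_digraph D" and "C \<in> dicycles D"
  obtains p where "pre_digraph.cycle D p" and "C = set p" and "2 \<le> length p"
    and "distinct p" and "inj_on (tail D) C" and "head D ` C = tail D ` C"
proof -
  interpret wf_digraph D by fact
  obtain p where p: "cycle p" "C = set p" "2 \<le> length p"
    using assms(2) unfolding dicycles_def by auto
  then have "distinct (map (tail D) p)" and "map (head D) p = rotate1 (map (tail D) p)"
    unfolding cycle_iff_rotate1 by auto
  then show thesis
    using that[OF p] p(2) by (metis distinct_map list.set_map set_rotate1)
qed

lemma card_dicycle:
  assumes "wf_digraph D" and "C \<in> dicycles D"
  shows "card (dicycle_verts D C) = card C" and "2 \<le> card C"
proof -
  obtain p where p: "C = set p" "2 \<le> length p" "distinct p" "inj_on (tail D) C"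
    using dicycleE[OF assms] by metis
  show "card (dicycle_verts D C) = card C"
    unfolding dicycle_verts_def using p(4) by (rule card_image)
  show "2 \<le> card C"
    using p(1-3) distinct_card by metis
qed

lemma dicycle_predecessor:
  assumes "wf_digraph D" and "C \<in> dicycles D" and "v \<in> dicycle_verts D C"
  obtains u where "u \<in> dicycle_verts D C" and "u \<rightarrow>\<^bsub>D\<^esub> v"
proof -
  interpret wf_digraph D by fact
  obtain p where p: "cycle p" "C = set p" "head D ` C = tail D ` C"
    using dicycleE[OF assms(1,2)] by metis
  then obtain f where "f \<in> C" "v = head D f"
    using assms(3) unfolding dicycle_verts_def by blast
  moreover have "f \<in> arcs D"
    using p calculation unfolding cycle_iff_rotate1 by auto
  ultimately show thesis
    using that unfolding dicycle_verts_def by (metis imageI in_arcs_imp_in_arcs_ends)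
qed

text \<open>A cycle of minimum length inside \<open>W\<close> has no chord, since a chord would
  shortcut it to a shorter cycle inside \<open>W\<close>.\<close>

lemma ex_chordless_dicycle:
  assumes "digraph D" and "\<not> acyclic_digraph (D \<restriction> W)"
  obtains C where "C \<in> chordless_dicycles D" and "dicycle_verts D C \<subseteq> W"
proof -
  interpret digraph D by fact
  define Q where "Q p \<longleftrightarrow> cycle p \<and> tail D ` set p \<subseteq> W" for p
  have "\<exists>p. Q p"
    using assms(2) unfolding acyclic_digraph_def cycle_induce_subgraph Q_def by blast
  then obtain p where p: "Q p" and min: "\<And>q. Q q \<Longrightarrow> length p \<le> length q"
    using ex_has_least_nat[of Q] by metis
  have cyc: "cycle p" and W: "tail D ` set p \<subseteq> W"
    using p unfolding Q_def by auto
  have "set p \<in> dicycles D"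
    using cyc unfolding dicycles_def cycle_digraph_conv by blast
  moreover have "f \<in> set p"
    if f: "f \<in> arcs D" "tail D f \<in> tail D ` set p" "head D f \<in> tail D ` set p" for f
  proof (rule ccontr)
    assume "f \<notin> set p"
    \<comment> \<open>The cycle is rotated to start with the arc \<open>g\<close> that leaves the
      end of the chord \<open>f\<close>; \<open>h\<close> is the cycle arc that leaves the start of
      \<open>f\<close>. Replacing \<open>h # s\<close> by \<open>f\<close> then gives the shorter
      cycle.\<close>
    obtain g where g: "g \<in> set p" "tail D g = head D f"
      using f(3) by (metis imageE)
    obtain r where r: "cycle (g # r)" "set (g # r) = set p" "length (g # r) = length p"
      using cycle_rotateE[OF cyc g(1)] .
    obtain h where h: "h \<in> set p" "tail D h = tail D f"
      using f(2) by (metis imageE)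
    have "h \<noteq> g"
      using g h no_loops[OF f(1)] by metis
    then obtain q s where qs: "r = q @ h # s"
      using h(1) r(2) split_list[of h r] by auto
    have rr: "distinct (map (tail D) (g # r))" "set (g # r) \<subseteq> arcs D"
      "map (head D) (g # r) = rotate1 (map (tail D) (g # r))"
      using r(1) unfolding cycle_iff_rotate1 by auto
    \<comment> \<open>If \<open>h\<close> were the last arc, it would be parallel to
      \<open>f\<close>. Non-emptiness of \<open>s\<close> is what makes the new cycle strictly
      shorter.\<close>
    have "s \<noteq> []"
    proof
      assume "s = []"
      then have "head D h = head D f"
        using rr(3) g(2) unfolding qs by simp
      then show False
        using no_multi_arcs[of h f] h \<open>f \<notin> set p\<close> f(1) rr(2) unfolding r(2)
        by (auto simp: arc_to_ends_def)
    qed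
    have "map (head D) (g # q) = map (tail D) q @ [tail D h]"
      using arg_cong[OF rr(3), of "take (Suc (length q))"] unfolding qs by simp
    then have "Q (f # g # q)"
      using rr f(1,2) g(2) h(2) W unfolding Q_def cycle_iff_rotate1 qs r(2)[symmetric] by auto
    from min[OF this] show False
      using r(3) \<open>s \<noteq> []\<close> unfolding qs by (cases s) auto
  qed
  ultimately show thesis
    using that[of "set p"] W unfolding chordless_dicycles_def dicycle_verts_def by auto
qed

text \<open>For lack of chords, a cycle on the vertices of \<open>C\<close> uses arcs of
  \<open>C\<close> only. Each of these vertices has a single outgoing arc in \<open>C\<close>, so
  the cycle must run through all of \<open>C\<close>, including \<open>e\<close>.\<close>

lemma acyclic_del_arc_chordless_dicycle:
  assumes "wf_digraph D" and "C \<in> chordless_dicycles D" and "e \<in> C"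
  shows "acyclic_digraph (pre_digraph.del_arc D e \<restriction> dicycle_verts D C)"
  unfolding acyclic_digraph_def
proof
  interpret wf_digraph D by fact
  interpret H: wf_digraph "del_arc e" by (rule wf_digraph_del_arc)
  have C: "C \<in> dicycles D" "arcs (D \<restriction> dicycle_verts D C) \<subseteq> C"
    using assms(2) unfolding chordless_dicycles_def by auto
  obtain c where c: "cycle c" "C = set c" "inj_on (tail D) C"
    using dicycleE[OF assms(1) C(1)] by metis
  assume "\<exists>p. pre_digraph.cycle (del_arc e \<restriction> dicycle_verts D C) p"
  then obtain p where p: "cycle p" "e \<notin> set p" "tail D ` set p \<subseteq> dicycle_verts D C"
    unfolding H.cycle_induce_subgraph cycle_del_arc by auto
  have heads: "head D ` set p = tail D ` set p"
    using p(1) unfolding cycle_iff_rotate1 by (metis list.set_map set_rotate1)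
  have "set p \<subseteq> arcs D" "p \<noteq> []"
    using p(1) unfolding cycle_iff_rotate1 by auto
  then have sub: "set p \<subseteq> C"
    using p(3) C(2) heads by fastforce
  have closed: "f \<in> set p" if "f \<in> C" "tail D f \<in> tail D ` set p" for f
    using that sub inj_onD[OF c(3), of f] by (auto 4 3)
  obtain f where "f \<in> set p"
    using \<open>p \<noteq> []\<close> by (meson list.set_sel(1))
  then have "f \<in> set c"
    using sub c(2) by auto
  then obtain q where q: "cycle (f # q)" "set (f # q) = C"
    using cycle_rotateE[OF c(1)] c(2) by metis
  have rot: "map (head D) (f # q) = rotate1 (map (tail D) (f # q))"
    using q(1) unfolding cycle_iff_rotate1 by simp
  \<comment> \<open>Going round \<open>C\<close> from a common arc \<open>f\<close>: if an arc lies
    on \<open>p\<close>, its head is a tail on \<open>p\<close>, hence the next arc of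
    \<open>C\<close> lies on \<open>p\<close> too.\<close>
  have "(f # q) ! i \<in> set p" if "i < length (f # q)" for i
    using that
  proof (induction i)
    case (Suc i)
    have "head D ((f # q) ! i) = map (head D) (f # q) ! i"
      using Suc.prems by (simp only: nth_map Suc_lessD)
    also have "\<dots> = map (tail D) (f # q) ! Suc i"
      unfolding rot using nth_rotate1[of i "map (tail D) (f # q)"] Suc.prems by simp
    also have "\<dots> = tail D ((f # q) ! Suc i)"
      using Suc.prems by (simp only: nth_map)
    finally have "head D ((f # q) ! i) = tail D ((f # q) ! Suc i)" .
    moreover have "(f # q) ! i \<in> set p"
      using Suc by simp
    ultimately show ?case
      using closed[of "(f # q) ! Suc i"] heads Suc.prems q(2) by (metis imageI nth_mem)
  qed (use \<open>f \<in> set p\<close> in simp)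
  then have "C \<subseteq> set p"
    unfolding q(2)[symmetric] by (metis in_set_conv_nth subsetI)
  then show False
    using p(2) assms(3) by auto
qed

subsection \<open>Rate bounds\<close>

lemma card_words: "card (words k) = 2 ^ k" and finite_words: "finite (words k)"
proof -
  have "words k = {w. set w \<subseteq> UNIV \<and> length w = k}"
    unfolding words_def by simp
  then show "card (words k) = 2 ^ k" "finite (words k)"
    using card_lists_length_eq[of "UNIV :: bool set" k] finite_lists_length_eq[of "UNIV :: bool set" k]
    by simp_all
qed

text \<open>
  Two messages that agree outside \<open>K\<close> and have the same codeword agree everywhere: otherwise apply
  the hypothesis to the set of entries where they differ.
\<close>

lemma sic_code_sum_le:
  fixes D :: "('n::finite, 'b) pre_digraph"
  assumes code: "sic_code D P t r \<phi> \<psi>"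
    and K: "\<And>A. A \<subseteq> K \<Longrightarrow> A \<noteq> {} \<Longrightarrow> \<exists>v\<in>A. side_info_ord D P v \<inter> A = {}"
  shows "(\<Sum>v\<in>K. t v) \<le> r"
proof -
  \<comment> \<open>Entries outside \<open>K\<close> are frozen to all-zero words of the right
    length, so only the entries in \<open>K\<close> vary and any knowledge of the others is
    worthless.\<close>
  define ext where "ext g = (\<lambda>i. if i \<in> K then g i else replicate (t i) False)"
    for g :: "'n \<Rightarrow> bool list"
  let ?M = "PiE K (\<lambda>i. words (t i))"
  have ext: "ext g \<in> messages t" if "g \<in> ?M" for g
    using that unfolding messages_def ext_def words_def by (auto simp: PiE_def Pi_def)
  have "inj_on (\<lambda>g. \<phi> (ext g)) ?M"
  proof (rule inj_onI)
    fix g h assume g: "g \<in> ?M" and h: "h \<in> ?M" and eq: "\<phi> (ext g) = \<phi> (ext h)"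
    have "{v. ext g v \<noteq> ext h v} = {}"
    proof (rule ccontr)
      assume "{v. ext g v \<noteq> ext h v} \<noteq> {}"
      moreover have "{v. ext g v \<noteq> ext h v} \<subseteq> K"
        unfolding ext_def by auto
      ultimately obtain v where v: "ext g v \<noteq> ext h v"
        "side_info_ord D P v \<inter> {v. ext g v \<noteq> ext h v} = {}"
        using K[of "{v. ext g v \<noteq> ext h v}"] by auto
      then have "restrict (ext g) (side_info_ord D P v) = restrict (ext h) (side_info_ord D P v)"
        by (auto simp: restrict_def fun_eq_iff)
      then have "ext g v = ext h v"
        using code ext[OF g] ext[OF h] eq unfolding sic_code_def by metis
      then show False
        using v(1) by simp
    qed
    then have "g v = h v" if "v \<in> K" for v
      using that unfolding ext_def set_eq_iff by (auto dest: spec[of _ v])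
    then show "g = h"
      using PiE_ext[OF g h] by simp
  qed
  moreover have "(\<lambda>g. \<phi> (ext g)) ` ?M \<subseteq> words r"
    using code ext unfolding sic_code_def by auto
  ultimately have "card ?M \<le> card (words r)"
    by (rule card_inj_on_le) (rule finite_words)
  moreover have "card ?M = 2 ^ (\<Sum>v\<in>K. t v)"
    by (simp add: card_PiE card_words power_sum)
  ultimately show ?thesis
    by (simp add: card_words)
qed

lemma rate_region_sum_le_1:
  fixes D :: "('n::finite, 'b) pre_digraph"
  assumes "R \<in> rate_region D P"
    and "\<And>A. A \<subseteq> K \<Longrightarrow> A \<noteq> {} \<Longrightarrow> \<exists>v\<in>A. side_info_ord D P v \<inter> A = {}"
  shows "(\<Sum>v\<in>K. R $ v) \<le> 1"
proof -
  obtain t r \<phi> \<psi> where "0 < r" "sic_code D P t r \<phi> \<psi>" and R: "\<And>j. R $ j \<le> real (t j) / real r"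
    using assms(1) unfolding rate_region_def by auto
  then have "real (\<Sum>v\<in>K. t v) \<le> real r"
    using sic_code_sum_le[OF _ assms(2)] of_nat_le_iff by blast
  have "(\<Sum>v\<in>K. R $ v) \<le> (\<Sum>v\<in>K. real (t v) / real r)"
    using R by (rule sum_mono)
  also have "\<dots> = real (\<Sum>v\<in>K. t v) / real r"
    by (simp add: sum_divide_distrib)
  also have "\<dots> \<le> 1"
    using \<open>real (\<Sum>v\<in>K. t v) \<le> real r\<close> \<open>0 < r\<close> by simp
  finally show ?thesis .
qed

lemma decoding_order_minimal:
  assumes "decoding_order P" and "finite A" and "A \<noteq> {}"
  obtains v where "v \<in> A" and "\<And>u. u \<in> A \<Longrightarrow> (u, v) \<notin> P"
proof -
  have "acyclic P"
    using assms(1) unfolding decoding_order_def acyclic_irrefl by simp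
  then have "acyclic (P \<inter> A \<times> A)"
    by (rule acyclic_subset) auto
  then have "wf (P \<inter> A \<times> A)"
    using assms(2) by (intro finite_acyclic_wf) auto
  moreover obtain a where "a \<in> A"
    using assms(3) by auto
  ultimately obtain v where v: "v \<in> A" and min: "\<And>u. (u, v) \<in> P \<inter> A \<times> A \<Longrightarrow> u \<notin> A"
    by (rule wfE_min) blast
  show thesis
  proof (rule that[OF v])
    show "(u, v) \<notin> P" if "u \<in> A" for u
      using min[of u] v that by blast
  qed
qed

text \<open>A half-space is convex, so a linear bound valid for every decoding order survives the
  convex hull.\<close>

lemma capacity_region_sum_le:
  fixes D :: "('n::finite, 'b) pre_digraph"
  assumes "\<And>P R. decoding_order P \<Longrightarrow> R \<in> rate_region D P \<Longrightarrow> (\<Sum>v\<in>K. R $ v) \<le> c"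
    and "R \<in> capacity_region D"
  shows "(\<Sum>v\<in>K. R $ v) \<le> c"
proof -
  have "convex {R :: real ^ 'n. (\<Sum>v\<in>K. R $ v) \<le> c}"
  proof (rule convexI)
    fix x y :: "real ^ 'n" and a b :: real
    assume xy: "x \<in> {R. (\<Sum>v\<in>K. R $ v) \<le> c}" "y \<in> {R. (\<Sum>v\<in>K. R $ v) \<le> c}"
      and ab: "0 \<le> a" "0 \<le> b" "a + b = 1"
    have "(\<Sum>v\<in>K. (a *\<^sub>R x + b *\<^sub>R y) $ v) = a * (\<Sum>v\<in>K. x $ v) + b * (\<Sum>v\<in>K. y $ v)"
      by (simp add: sum.distrib sum_distrib_left)
    also have "\<dots> \<le> a * c + b * c"
      using xy ab by (intro add_mono mult_left_mono) auto
    also have "\<dots> = c"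
      using ab(3) by (metis distrib_right mult_1)
    finally show "a *\<^sub>R x + b *\<^sub>R y \<in> {R. (\<Sum>v\<in>K. R $ v) \<le> c}"
      by simp
  qed
  then show ?thesis
    using hull_minimal[of "\<Union>P\<in>{P. decoding_order P}. rate_region D P"
        "{R. (\<Sum>v\<in>K. R $ v) \<le> c}" convex] assms
    unfolding capacity_region_def by auto
qed

text \<open>In any part of a clique, a vertex minimal in the decoding order has arcs from all the
  others: their messages are neither its side information nor decoded before it.\<close>

lemma capacity_region_clique:
  fixes D :: "('n::finite, 'b) pre_digraph"
  assumes "K \<in> cliques D" and "R \<in> capacity_region D"
  shows "(\<Sum>v\<in>K. R $ v) \<le> 1"
proof (rule capacity_region_sum_le[OF _ assms(2)])
  fix P R assume P: "decoding_order P" and R: "R \<in> rate_region D P"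
  show "(\<Sum>v\<in>K. R $ v) \<le> 1"
  proof (rule rate_region_sum_le_1[OF R])
    fix A assume A: "A \<subseteq> K" "A \<noteq> {}"
    obtain v where "v \<in> A" "\<And>u. u \<in> A \<Longrightarrow> (u, v) \<notin> P"
      using decoding_order_minimal[OF P _ A(2)] by auto
    moreover have "u \<rightarrow>\<^bsub>D\<^esub> w" if "u \<in> A" "w \<in> A" "u \<noteq> w" for u w
      using that A(1) assms(1) unfolding cliques_def by blast
    ultimately show "\<exists>v\<in>A. side_info_ord D P v \<inter> A = {}"
      unfolding side_info_ord_def side_info_def by blast
  qed
qed

text \<open>
  For any decoding order, a minimal vertex \<open>v\<close> of \<open>V\<close> and a predecessor of it in \<open>V\<close> have rates
  summing to at most 1; each other rate is at most 1.
\<close>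

lemma capacity_region_no_source:
  fixes D :: "('n::finite, 'b) pre_digraph"
  assumes "loopfree_digraph D" and "V \<noteq> {}" and "\<And>v. v \<in> V \<Longrightarrow> \<exists>u\<in>V. u \<rightarrow>\<^bsub>D\<^esub> v"
    and "R \<in> capacity_region D"
  shows "(\<Sum>v\<in>V. R $ v) \<le> real (card V) - 1"
proof (rule capacity_region_sum_le[OF _ assms(4)])
  interpret loopfree_digraph D by fact
  fix P R assume P: "decoding_order P" and R: "R \<in> rate_region D P"
  have refl: "(v, v) \<notin> P" for v
    using P unfolding decoding_order_def irrefl_def by auto
  obtain v where v: "v \<in> V" "\<And>u. u \<in> V \<Longrightarrow> (u, v) \<notin> P"
    using decoding_order_minimal[OF P _ assms(2)] by auto
  then obtain u where u: "u \<in> V" "u \<rightarrow>\<^bsub>D\<^esub> v"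
    using assms(3) by blast
  have "u \<noteq> v"
    using u(2) adj_not_same by blast
  have single: "side_info_ord D P w \<inter> {w} = {}" for w
    using refl unfolding side_info_ord_def side_info_def by auto
  have pair: "side_info_ord D P v \<inter> {u, v} = {}"
    using refl u v(2) unfolding side_info_ord_def side_info_def by auto
  have "\<exists>w\<in>A. side_info_ord D P w \<inter> A = {}" if "A \<subseteq> {u, v}" "A \<noteq> {}" for A
  proof (cases "v \<in> A")
    case False
    then have "A = {u}"
      using that by auto
    then show ?thesis
      using single by simp
  qed (use that pair in blast)
  then have uv: "R $ u + R $ v \<le> 1"
    using rate_region_sum_le_1[OF R, of "{u, v}"] \<open>u \<noteq> v\<close> by simp
  have one: "R $ w \<le> 1" for w
    using rate_region_sum_le_1[OF R, of "{w}"] single by (simp add: subset_singleton_iff)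
  have split: "V = {u, v} \<union> (V - {u, v})"
    using u v by auto
  have "(\<Sum>v\<in>V. R $ v) = R $ u + R $ v + (\<Sum>w\<in>V - {u, v}. R $ w)"
    by (subst split, subst sum.union_disjoint) (use \<open>u \<noteq> v\<close> in auto)
  also have "\<dots> \<le> 1 + (\<Sum>w\<in>V - {u, v}. 1)"
    using uv one by (intro add_mono sum_mono)
  also have "\<dots> = real (card V) - 1"
  proof -
    have "card V = 2 + card (V - {u, v})"
      by (subst split, subst card_Un_disjoint) (use \<open>u \<noteq> v\<close> in auto)
    then show ?thesis
      by simp
  qed
  finally show "(\<Sum>v\<in>V. R $ v) \<le> real (card V) - 1" .
qed

section \<open>Achievable rates from acyclic vertex sets\<close>

definition indicator_vec :: "'n set \<Rightarrow> real ^ 'n" where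
  "indicator_vec W = (\<chi> v. of_bool (v \<in> W))"

text \<open>
  Receivers in \<open>W\<close> are served in an order extending the arcs inside \<open>W\<close>, so that each of them knows
  all of \<open>W\<close> but its own bit; the transmitter sends the parity of the bits of \<open>W\<close>.
\<close>

lemma indicator_vec_in_capacity_region:
  fixes D :: "('n::finite, 'b) pre_digraph"
  assumes "wf_digraph D" and "acyclic_digraph (D \<restriction> W)"
  shows "indicator_vec W \<in> capacity_region D"
proof -
  interpret wf_digraph D by fact
  interpret H: wf_digraph "D \<restriction> W" ..
  define P where "P = (arcs_ends (D \<restriction> W))\<^sup>+"
  have "(v, v) \<notin> P" for v
    using assms(2) H.closed_w_imp_cycle H.reachable1_awalk[of v v]
    unfolding P_def acyclic_digraph_def H.closed_w_def by blast
  then have P: "decoding_order P"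
    unfolding decoding_order_def irrefl_def P_def by auto
  \<comment> \<open>An arc from \<open>i\<close> to \<open>j\<close> inside \<open>W\<close> puts
    \<open>i\<close> before \<open>j\<close> in the order; without an arc, \<open>i\<close> is side
    information from the start.\<close>
  have known: "i \<in> side_info_ord D P j" if "i \<in> W" "j \<in> W" "i \<noteq> j" for i j
  proof (cases "i \<rightarrow>\<^bsub>D\<^esub> j")
    case True
    then have "(i, j) \<in> arcs_ends (D \<restriction> W)"
      using that by (auto simp: arcs_ends_def arc_to_ends_def)
    then show ?thesis
      unfolding side_info_ord_def P_def by auto
  qed (use that in \<open>simp add: side_info_ord_def side_info_def\<close>)
  \<comment> \<open>One bit for each vertex of \<open>W\<close>, the empty word for all others,
    whose decoders then return \<open>[]\<close>.\<close>
  define t :: "'n \<Rightarrow> nat" where "t j = of_bool (j \<in> W)" for j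
  define \<phi> :: "('n \<Rightarrow> bool list) \<Rightarrow> bool list"
    where "\<phi> x = [odd (card {i \<in> W. x i = [True]})]" for x
  \<comment> \<open>On bits, \<open>\<noteq>\<close> is exclusive or: removing the parity of the
    other bits of \<open>W\<close> from the received parity leaves the bit of
    \<open>j\<close>.\<close>
  define \<psi> :: "'n \<Rightarrow> bool list \<Rightarrow> ('n \<Rightarrow> bool list) \<Rightarrow> bool list"
    where "\<psi> j w y = (if j \<in> W then [hd w \<noteq> odd (card {i \<in> W - {j}. y i = [True]})] else [])" for j w y
  have "\<psi> j (\<phi> x) (restrict x (side_info_ord D P j)) = x j" if x: "x \<in> messages t" for j x
  proof (cases "j \<in> W")
    case True
    then have "length (x j) = 1"
      using x unfolding messages_def words_def t_def by (simp add: Pi_iff)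
    then obtain b where b: "x j = [b]"
      by (auto simp: length_Suc_conv)
    let ?A = "{i \<in> W - {j}. x i = [True]}"
    have "{i \<in> W - {j}. restrict x (side_info_ord D P j) i = [True]} = ?A"
      using known True by auto
    moreover have "{i \<in> W. x i = [True]} = (if b then insert j ?A else ?A)"
      using True b by auto
    ultimately show ?thesis
      using True b unfolding \<phi>_def \<psi>_def by auto
  next
    case False
    then have "length (x j) = 0"
      using x unfolding messages_def words_def t_def by (simp add: Pi_iff)
    then show ?thesis
      using False unfolding \<psi>_def by simp
  qed
  then have "sic_code D P t 1 \<phi> \<psi>"
    unfolding sic_code_def by (auto simp: \<phi>_def words_def)
  then have "indicator_vec W \<in> rate_region D P"
    unfolding rate_region_def indicator_vec_def t_def by force
  then show ?thesis
    using P unfolding capacity_region_def by (auto intro: hull_inc)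
qed

lemma convex_capacity_region: "convex (capacity_region D)"
  unfolding capacity_region_def by (rule convex_convex_hull)

lemma broadcast_rate_le:
  assumes "0 < b" and "(\<chi> j. 1 / b) \<in> capacity_region D"
  shows "broadcast_rate D \<le> b"
  unfolding broadcast_rate_def
proof (rule cInf_lower)
  show "bdd_below {b. 0 < b \<and> (\<chi> j. 1 / b) \<in> capacity_region D}"
    by (rule bdd_belowI[of _ 0]) simp
qed (use assms in simp)

text \<open>Serves the sets in \<open>F\<close> for equal fractions of time.\<close>

lemma cover_in_capacity_region:
  fixes D :: "('n::finite, 'b) pre_digraph" and F :: "'i \<Rightarrow> 'n set"
  assumes D: "wf_digraph D" "\<And>i. i \<in> I \<Longrightarrow> acyclic_digraph (D \<restriction> F i)"
    and I: "finite I" "I \<noteq> {}"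
    and cover: "\<And>v. card {i \<in> I. v \<in> F i} = m"
  shows "(\<chi> v. real m / real (card I)) \<in> capacity_region D"
proof -
  have "(\<Sum>i\<in>I. (1 / real (card I)) *\<^sub>R indicator_vec (F i)) \<in> capacity_region D"
    using I D by (intro convex_sum convex_capacity_region indicator_vec_in_capacity_region) auto
  also have "(\<Sum>i\<in>I. (1 / real (card I)) *\<^sub>R indicator_vec (F i)) = (\<chi> v. real m / real (card I))"
  proof (rule iffD2[OF vec_eq_iff], rule allI)
    fix v
    have "(\<Sum>i\<in>I. of_bool (v \<in> F i)) = real (card (I \<inter> {i. v \<in> F i}))"
      using I(1) by simp
    also have "I \<inter> {i. v \<in> F i} = {i \<in> I. v \<in> F i}"
      by auto
    finally show "(\<Sum>i\<in>I. (1 / real (card I)) *\<^sub>R indicator_vec (F i)) $ v = (\<chi> v. real m / real (card I)) $ v"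
      by (simp add: indicator_vec_def cover flip: sum_divide_distrib)
  qed
  finally show ?thesis .
qed

lemma (in loopfree_digraph) acyclic_singleton: "acyclic_digraph (G \<restriction> {v})"
  unfolding acyclic_digraph_def cycle_induce_subgraph
proof
  assume "\<exists>p. cycle p \<and> tail G ` set p \<subseteq> {v}"
  then obtain p where p: "p \<noteq> []" "set p \<subseteq> arcs G" "tail G ` set p \<subseteq> {v}"
    "map (head G) p = rotate1 (map (tail G) p)"
    unfolding cycle_iff_rotate1 by auto
  obtain f where f: "f \<in> set p"
    using p(1) by (meson list.set_sel(1))
  have "head G ` set p = tail G ` set p"
    using p(4) by (metis list.set_map set_rotate1)
  then have "head G f \<in> {v}" "tail G f \<in> {v}"
    using f p(3) by blast+
  then show False
    using f p(2) no_loops[of f] by auto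
qed

text \<open>Passing from a bound on every admissible \<open>b\<close> to the infimum requires that
  some \<open>b\<close> is admissible. Serving the vertices one at a time provides
  \<open>CARD('n)\<close>.\<close>

lemma broadcast_rate_ge:
  fixes D :: "('n::finite, 'b) pre_digraph"
  assumes D: "loopfree_digraph D"
    and bound: "\<And>b. 0 < b \<Longrightarrow> (\<chi> j. 1 / b) \<in> capacity_region D \<Longrightarrow> c \<le> b"
  shows "c \<le> broadcast_rate D"
proof -
  interpret loopfree_digraph D by fact
  have "acyclic_digraph (D \<restriction> {v})" for v
    by (rule acyclic_singleton)
  then have "(\<chi> v. real 1 / real (card (UNIV :: 'n set))) \<in> capacity_region D"
    by (intro cover_in_capacity_region[where F = "\<lambda>v. {v}", OF wf_digraph_axioms]) auto
  then have "{b. 0 < b \<and> (\<chi> j. 1 / b) \<in> capacity_region D} \<noteq> {}"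
    by (auto intro!: exI[of _ "real CARD('n)"])
  then show ?thesis
    unfolding broadcast_rate_def using bound by (intro cInf_greatest) auto
qed

subsection \<open>Critical arcs\<close>

lemma clique_le_broadcast_rate:
  assumes "loopfree_digraph D" and "K \<in> cliques D"
  shows "real (card K) \<le> broadcast_rate D"
proof (rule broadcast_rate_ge[OF assms(1)])
  fix b :: real assume "0 < b" "(\<chi> j. 1 / b) \<in> capacity_region D"
  then show "real (card K) \<le> b"
    using capacity_region_clique[OF assms(2), of "\<chi> j. 1 / b"] by simp
qed

lemma dicycle_le_broadcast_rate:
  fixes D :: "('n::finite, 'b) pre_digraph"
  assumes "loopfree_digraph D" and "C \<in> dicycles D"
  shows "real (card C) / (real (card C) - 1) \<le> broadcast_rate D"
proof (rule broadcast_rate_ge[OF assms(1)])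
  interpret loopfree_digraph D by fact
  let ?V = "dicycle_verts D C"
  have card: "card ?V = card C" "2 \<le> card C"
    using card_dicycle[OF wf_digraph_axioms assms(2)] by auto
  then have ne: "?V \<noteq> {}"
    by auto
  fix b :: real assume b: "0 < b" "(\<chi> j. 1 / b) \<in> capacity_region D"
  \<comment> \<open>Every vertex of a dicycle has a predecessor on it, so the bound for sets without
    a source applies.\<close>
  have "(\<Sum>v\<in>?V. (\<chi> j. 1 / b) $ v) \<le> real (card ?V) - 1"
    using dicycle_predecessor[OF wf_digraph_axioms assms(2)]
    by (intro capacity_region_no_source[OF assms(1) ne] b(2)) blast
  then have "real (card C) / b \<le> real (card C) - 1"
    using card(1) by simp
  then show "real (card C) / (real (card C) - 1) \<le> b"
    using b(1) card(2) by (simp add: field_simps)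
qed

section \<open>Acyclic vertex sets after deleting an arc\<close>

lemma induce_subgraph_induce_subgraph: "W' \<subseteq> W \<Longrightarrow> (D \<restriction> W) \<restriction> W' = D \<restriction> W'"
  by (auto simp: induce_subgraph_def)

lemma acyclic_del_arc:
  assumes "wf_digraph D" and "acyclic_digraph (D \<restriction> W)"
  shows "acyclic_digraph (pre_digraph.del_arc D e \<restriction> W)"
proof -
  interpret wf_digraph D by fact
  interpret H: wf_digraph "del_arc e" by (rule wf_digraph_del_arc)
  show ?thesis
    using assms(2) unfolding acyclic_digraph_def H.cycle_induce_subgraph cycle_induce_subgraph
      cycle_del_arc by auto
qed

text \<open>Without loops and parallel arcs, only an arc opposite to \<open>e\<close> can remain
  between the two ends, and it closes no cycle by itself.\<close>

lemma (in digraph) acyclic_del_arc_ends: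
  assumes "e \<in> arcs G"
  shows "acyclic_digraph (del_arc e \<restriction> {tail G e, head G e})"
  unfolding acyclic_digraph_def
proof
  interpret H: wf_digraph "del_arc e" by (rule wf_digraph_del_arc)
  assume "\<exists>p. pre_digraph.cycle (del_arc e \<restriction> {tail G e, head G e}) p"
  then obtain p where p: "cycle p" "e \<notin> set p" "tail G ` set p \<subseteq> {tail G e, head G e}"
    unfolding H.cycle_induce_subgraph cycle_del_arc by auto
  have heads: "head G ` set p = tail G ` set p" and "set p \<subseteq> arcs G" "p \<noteq> []"
    using p(1) unfolding cycle_iff_rotate1 by (metis list.set_map set_rotate1, auto)
  have "tail G f = head G e \<and> head G f = tail G e" if f: "f \<in> set p" for f
  proof -
    have "tail G f \<in> {tail G e, head G e}" "head G f \<in> {tail G e, head G e}"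
      using f p(3) heads by blast+
    moreover have "tail G f \<noteq> head G f" "f \<in> arcs G" "f \<noteq> e"
      using f \<open>set p \<subseteq> arcs G\<close> no_loops p(2) by auto
    ultimately show ?thesis
      using no_multi_arcs[of f e] assms by (auto simp: arc_to_ends_def)
  qed
  moreover obtain f where "f \<in> set p"
    using \<open>p \<noteq> []\<close> by (meson list.set_sel(1))
  ultimately have "head G e = tail G e"
    using heads by (metis imageE imageI)
  then show False
    using no_loops[OF assms] by simp
qed

section \<open>Perfect digraphs\<close>

lemma dichromatic_partition:
  fixes D :: "('n::finite, 'b) pre_digraph"
  assumes "loopfree_digraph D"
  obtains P where "partition_on W P" and "card P = dichromatic_number (D \<restriction> W)"
    and "\<And>U. U \<in> P \<Longrightarrow> acyclic_digraph (D \<restriction> U)"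
proof -
  interpret loopfree_digraph D by fact
  let ?Q = "\<lambda>k. \<exists>P. partition_on (verts (D \<restriction> W)) P \<and> card P = k \<and>
    (\<forall>U\<in>P. acyclic_digraph ((D \<restriction> W) \<restriction> U))"
  \<comment> \<open>The partition into singletons shows that the \<open>LEAST\<close> in the
    dichromatic number is attained.\<close>
  have "partition_on W ((\<lambda>v. {v}) ` W)"
    by (auto simp: partition_on_def disjoint_def)
  moreover have "acyclic_digraph ((D \<restriction> W) \<restriction> U)" if "U \<in> (\<lambda>v. {v}) ` W" for U
    using that acyclic_singleton by (auto simp: induce_subgraph_induce_subgraph)
  ultimately have "?Q (card ((\<lambda>v. {v}) ` W))"
    by auto
  then have "?Q (dichromatic_number (D \<restriction> W))"
    unfolding dichromatic_number_def by (rule LeastI)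
  then obtain P where P: "partition_on W P" "card P = dichromatic_number (D \<restriction> W)"
    "\<forall>U\<in>P. acyclic_digraph ((D \<restriction> W) \<restriction> U)"
    by auto
  moreover have "U \<subseteq> W" if "U \<in> P" for U
    using that P(1) unfolding partition_on_def by auto
  ultimately show thesis
    using that by (metis induce_subgraph_induce_subgraph)
qed

text \<open>A clique of size \<open>card K\<close> avoiding \<open>u\<close> would be a largest
  clique of \<open>D\<close> other than \<open>K\<close>.\<close>

lemma clique_number_less:
  fixes D :: "('n::finite, 'b) pre_digraph"
  assumes "verts D = UNIV" and "largest_cliques D = {K}" and "u \<in> K"
  shows "clique_number (D \<restriction> (UNIV - {u})) < card K"
proof -
  have K: "K \<in> cliques D" "\<And>X. X \<in> cliques D \<Longrightarrow> card X \<le> card K"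
    using assms(2) unfolding largest_cliques_def by auto
  let ?Q = "cliques (D \<restriction> (UNIV - {u}))"
  have "card X < card K" if X: "X \<in> ?Q" for X
  proof (rule ccontr)
    assume "\<not> card X < card K"
    have "arcs_ends (D \<restriction> (UNIV - {u})) \<subseteq> arcs_ends D"
      by (auto simp: arcs_ends_def arc_to_ends_def)
    then have "X \<in> cliques D" "u \<notin> X"
      using X assms(1) unfolding cliques_def by auto
    then have "X \<in> largest_cliques D"
      using K \<open>\<not> card X < card K\<close> unfolding largest_cliques_def by fastforce
    then show False
      using assms(2,3) \<open>u \<notin> X\<close> by auto
  qed
  moreover have "{} \<in> ?Q"
    unfolding cliques_def by auto
  ultimately show ?thesis
    unfolding clique_number_def by (subst Max_less_iff) auto
qed

lemma card_partition_containing: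
  assumes "partition_on A P"
  shows "card {U \<in> P. x \<in> U} = of_bool (x \<in> A)"
proof (cases "x \<in> A")
  case True
  then obtain U where U: "U \<in> P" "x \<in> U"
    using assms unfolding partition_on_def by auto
  then have "{U \<in> P. x \<in> U} = {U}"
    using assms unfolding partition_on_def disjoint_def by auto
  then show ?thesis
    using True by simp
next
  case False
  then have "{U \<in> P. x \<in> U} = {}"
    using assms unfolding partition_on_def by auto
  then show ?thesis
    using False by (simp only: card.empty of_bool_eq)
qed

lemma critical_arc_perfect:
  fixes D :: "('n::finite, 'b) pre_digraph"
  assumes "digraph D" and "verts D = UNIV" and "e \<in> arcs D"
    and perfect: "perfect_digraph D" and K: "largest_cliques D = {K}"
    and e: "tail D e \<in> K" "head D e \<in> K"
  shows "critical_arc D e"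
proof -
  interpret digraph D by fact
  interpret H: wf_digraph "del_arc e" by (rule wf_digraph_del_arc)
  let ?u = "tail D e" and ?v = "head D e"
  have "?u \<noteq> ?v"
    using no_loops assms(3) by simp
  have colouring: "\<exists>P. partition_on (UNIV - {w}) P \<and> card P < card K \<and>
      (\<forall>U\<in>P. acyclic_digraph (del_arc e \<restriction> U))" if w: "w \<in> K" for w
  proof -
    obtain P where "partition_on (UNIV - {w}) P" "card P = dichromatic_number (D \<restriction> (UNIV - {w}))"
      "\<And>U. U \<in> P \<Longrightarrow> acyclic_digraph (D \<restriction> U)"
      using dichromatic_partition[OF loopfree_digraph_axioms] by metis
    moreover have "dichromatic_number (D \<restriction> (UNIV - {w})) < card K"
      using perfect clique_number_less[OF assms(2) K w] assms(2)
      unfolding perfect_digraph_def by auto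
    ultimately show ?thesis
      using acyclic_del_arc[OF wf_digraph_axioms] by metis
  qed
  obtain P where P: "partition_on (UNIV - {?u}) P" "card P < card K"
    "\<forall>U\<in>P. acyclic_digraph (del_arc e \<restriction> U)"
    using colouring[OF e(1)] by auto
  obtain Q where Q: "partition_on (UNIV - {?v}) Q" "card Q < card K"
    "\<forall>U\<in>Q. acyclic_digraph (del_arc e \<restriction> U)"
    using colouring[OF e(2)] by auto
  have notin: "{?u, ?v} \<notin> Q"
    using Q(1) unfolding partition_on_def by auto
  \<comment> \<open>The disjoint sum counts a set twice if it is a class of both \<open>P\<close>
    and \<open>Q\<close>.\<close>
  define F :: "'n set + 'n set \<Rightarrow> 'n set" where "F = case_sum (\<lambda>U. U) (\<lambda>U. U)"
  let ?I = "P <+> insert {?u, ?v} Q"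
  let ?m = "card ?I"
  have card_I: "?m = card P + Suc (card Q)"
    using notin by (simp add: card_Plus)
  \<comment> \<open>The tail of \<open>e\<close> is missed by \<open>P\<close> and the head by
    \<open>Q\<close>, once each; the extra set makes up for both. All other vertices lie in one
    class of each partition.\<close>
  have cover: "card {i \<in> ?I. x \<in> F i} = 2" for x
  proof -
    have "{i \<in> ?I. x \<in> F i} = {U \<in> P. x \<in> U} <+> {U \<in> insert {?u, ?v} Q. x \<in> U}"
      by (auto simp: F_def)
    moreover have "{U \<in> insert {?u, ?v} Q. x \<in> U} =
        (if x \<in> {?u, ?v} then insert {?u, ?v} {U \<in> Q. x \<in> U} else {U \<in> Q. x \<in> U})"
      by auto
    ultimately show ?thesis
      using card_partition_containing[OF P(1), of x] card_partition_containing[OF Q(1), of x]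
        notin \<open>?u \<noteq> ?v\<close> by (auto simp: card_Plus)
  qed
  have "acyclic_digraph (del_arc e \<restriction> F i)" if "i \<in> ?I" for i
    using that P(3) Q(3) acyclic_del_arc_ends[OF assms(3)] by (auto simp: F_def)
  then have "(\<chi> v. real 2 / real ?m) \<in> capacity_region (del_arc e)"
    using cover by (intro cover_in_capacity_region[where F = F]) (auto intro: H.wf_digraph_axioms)
  then have "broadcast_rate (del_arc e) \<le> real ?m / 2"
    using card_I by (intro broadcast_rate_le) auto
  also have "\<dots> < real (card K)"
  proof -
    have "?m < 2 * card K"
      using P(2) Q(2) unfolding card_I by simp
    then show ?thesis
      by (simp add: divide_less_eq flip: of_nat_mult)
  qed
  also have "\<dots> \<le> broadcast_rate D"
    using K by (intro clique_le_broadcast_rate loopfree_digraph_axioms) (auto simp: largest_cliques_def)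
  finally show ?thesis
    using assms(3) unfolding critical_arc_def by simp
qed

section \<open>Ideal incidence matrices\<close>

lemma compact_covering_polytope: "compact (covering_polytope B)"
  and convex_covering_polytope: "convex (covering_polytope B)"
proof -
  have "covering_polytope B = cbox 0 1 \<inter> (\<Inter>b\<in>B. {y. b \<bullet> y \<ge> 1})"
    unfolding covering_polytope_def by (auto simp: mem_box_cart)
  then show "compact (covering_polytope B)" "convex (covering_polytope B)"
    by (auto intro!: compact_Int_closed closed_INT closed_halfspace_ge convex_Int convex_INT
        convex_halfspace_ge convex_box simp: compact_cbox)
qed

lemma inner_incidence_vector:
  "(\<chi> v. of_bool (v \<in> V)) \<bullet> (y :: real ^ 'n::finite) = (\<Sum>v\<in>V. y $ v)"
proof -
  have "(\<chi> v. of_bool (v \<in> V)) \<bullet> y = (\<Sum>v\<in>UNIV. if v \<in> V then y $ v else 0)"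
    unfolding inner_vec_def by (intro sum.cong) auto
  also have "\<dots> = (\<Sum>v\<in>V. y $ v)"
    by (simp add: sum.If_cases)
  finally show ?thesis .
qed

text \<open>
  By idealness, \<open>y\<close> is a convex combination of incidence vectors of vertex sets meeting every
  chordless dicycle, and the complements of those sets induce acyclic sub-digraphs.
\<close>

lemma covering_polytope_complement:
  fixes D :: "('n::finite, 'b) pre_digraph"
  assumes "digraph D" and ideal: "ideal_matrix (dicycle_vertex_incidence D)"
    and y: "y \<in> covering_polytope (dicycle_vertex_incidence D)"
  shows "1 - y \<in> convex hull (indicator_vec ` {W. acyclic_digraph (D \<restriction> W)})" (is "_ \<in> ?H")
proof -
  let ?P = "covering_polytope (dicycle_vertex_incidence D)"
  have ext: "1 - x \<in> ?H" if x: "x extreme_point_of ?P" for x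
  proof -
    let ?W = "{v. x $ v = 0}"
    have xP: "x \<in> ?P"
      using x unfolding extreme_point_of_def by simp
    have zero_one: "x $ v = 0 \<or> x $ v = 1" for v
    proof -
      obtain z where "x $ v = of_int z"
        using ideal x unfolding ideal_matrix_def by (meson Ints_cases)
      moreover have "0 \<le> x $ v" "x $ v \<le> 1"
        using xP unfolding covering_polytope_def by auto
      ultimately show ?thesis
        by (cases "z = 0") auto
    qed
    have "(1 - x) $ v = indicator_vec ?W $ v" for v
      unfolding indicator_vec_def using zero_one[of v] by auto
    then have "1 - x = indicator_vec ?W"
      by (simp add: vec_eq_iff)
    moreover have "acyclic_digraph (D \<restriction> ?W)"
    proof (rule ccontr)
      assume "\<not> acyclic_digraph (D \<restriction> ?W)"
      then obtain C where C: "C \<in> chordless_dicycles D" "dicycle_verts D C \<subseteq> ?W"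
        using ex_chordless_dicycle[OF assms(1)] by metis
      then have "1 \<le> (\<Sum>v\<in>dicycle_verts D C. x $ v)"
        using xP unfolding covering_polytope_def dicycle_vertex_incidence_def
        by (auto simp: inner_incidence_vector)
      also have "\<dots> = 0"
        using C(2) by (intro sum.neutral) auto
      finally show False
        by simp
    qed
    ultimately show ?thesis
      by (auto intro: hull_inc)
  qed
  \<comment> \<open>Convexity of this preimage extends the claim from the extreme points to the
    whole polytope, which is their convex hull by Krein-Milman.\<close>
  have "convex {x. 1 - x \<in> ?H}"
  proof (rule convexI)
    fix a b :: "real ^ 'n" and s t :: real
    assume ab: "a \<in> {x. 1 - x \<in> ?H}" "b \<in> {x. 1 - x \<in> ?H}" and st: "0 \<le> s" "0 \<le> t" "s + t = 1"
    have "s *\<^sub>R (1 - a) + t *\<^sub>R (1 - b) = (s + t) *\<^sub>R 1 - (s *\<^sub>R a + t *\<^sub>R b)"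
      by (simp add: algebra_simps)
    then show "s *\<^sub>R a + t *\<^sub>R b \<in> {x. 1 - x \<in> ?H}"
      using convexD[OF convex_convex_hull, of "1 - a" _ "1 - b" s t] ab st by simp
  qed
  then have "convex hull {x. x extreme_point_of ?P} \<subseteq> {x. 1 - x \<in> ?H}"
    using ext by (intro hull_minimal) auto
  then show ?thesis
    using y Krein_Milman_Minkowski[OF compact_covering_polytope convex_covering_polytope] by blast
qed

lemma critical_arc_ideal:
  fixes D :: "('n::finite, 'b) pre_digraph"
  assumes "digraph D" and "e \<in> arcs D"
    and ideal: "ideal_matrix (dicycle_vertex_incidence D)"
    and C: "shortest_chordless_dicycles D = {C}" and e: "e \<in> C"
  shows "critical_arc D e"
proof -
  interpret digraph D by fact
  interpret H: wf_digraph "del_arc e" by (rule wf_digraph_del_arc)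
  let ?V = "dicycle_verts D C"
  define k where "k = real (card C)"
  have chordless: "C \<in> chordless_dicycles D" and shortest: "\<And>C'. C' \<in> chordless_dicycles D \<Longrightarrow> card C \<le> card C'"
    using C unfolding shortest_chordless_dicycles_def by auto
  have dicycle: "C' \<in> dicycles D" if "C' \<in> chordless_dicycles D" for C'
    using that unfolding chordless_dicycles_def by simp
  have k: "2 \<le> k"
    using card_dicycle(2)[OF wf_digraph_axioms dicycle[OF chordless]] unfolding k_def by simp
  \<comment> \<open>Rows other than that of \<open>C\<close> have at least \<open>k + 1\<close> ones
    by uniqueness, so \<open>1 / (k + 1)\<close> per vertex suffices for them; the row of
    \<open>C\<close> is tight.\<close>
  define y :: "real ^ 'n" where "y = (\<chi> v. if v \<in> ?V then 1 / k else 1 / (k + 1))"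
  have "1 \<le> (\<Sum>v\<in>dicycle_verts D C'. y $ v)" if C': "C' \<in> chordless_dicycles D" for C'
  proof (cases "C' = C")
    case True
    then show ?thesis
      using k card_dicycle(1)[OF wf_digraph_axioms dicycle[OF C']] unfolding y_def k_def by simp
  next
    case False
    have "\<not> card C' \<le> card C"
    proof
      assume "card C' \<le> card C"
      then have "C' \<in> shortest_chordless_dicycles D"
        using C' shortest unfolding shortest_chordless_dicycles_def by fastforce
      then show False
        using C False by simp
    qed
    then have "k + 1 \<le> real (card (dicycle_verts D C'))"
      using card_dicycle(1)[OF wf_digraph_axioms dicycle[OF C']] unfolding k_def by simp
    then have "1 \<le> (\<Sum>v\<in>dicycle_verts D C'. 1 / (k + 1))"
      using k by simp
    also have "\<dots> \<le> (\<Sum>v\<in>dicycle_verts D C'. y $ v)"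
      using k by (intro sum_mono) (auto simp: y_def field_simps)
    finally show ?thesis .
  qed
  moreover have "0 \<le> y $ v \<and> y $ v \<le> 1" for v
    using k by (auto simp: y_def)
  ultimately have "y \<in> covering_polytope (dicycle_vertex_incidence D)"
    unfolding covering_polytope_def dicycle_vertex_incidence_def
    by (auto simp: inner_incidence_vector)
  then have "1 - y \<in> convex hull (indicator_vec ` {W. acyclic_digraph (D \<restriction> W)})"
    by (rule covering_polytope_complement[OF assms(1) ideal])
  moreover have "indicator_vec ` {W. acyclic_digraph (D \<restriction> W)} \<subseteq> capacity_region (del_arc e)"
    using acyclic_del_arc[OF wf_digraph_axioms] indicator_vec_in_capacity_region[OF H.wf_digraph_axioms]
    by blast
  ultimately have y: "1 - y \<in> capacity_region (del_arc e)"
    using hull_minimal[where S = convex, OF _ convex_capacity_region] by blast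
  have V: "indicator_vec ?V \<in> capacity_region (del_arc e)"
    using acyclic_del_arc_chordless_dicycle[OF wf_digraph_axioms chordless e]
    by (rule indicator_vec_in_capacity_region[OF H.wf_digraph_axioms])
  \<comment> \<open>The entries of \<open>1 - y\<close> on and off \<open>?V\<close> differ by
    \<open>1 / (k * (k + 1))\<close>, so weights in the ratio \<open>k * (k + 1)\<close> to 1
    balance them; \<open>q\<close> normalises the weights.\<close>
  define q where "q = k\<^sup>2 + k + 1"
  have q: "0 < q"
    using k unfolding q_def by (simp add: add_pos_pos)
  have on: "(k\<^sup>2 + k) / q * (1 - 1 / k) + 1 / q = k\<^sup>2 / q"
  proof -
    have "(k\<^sup>2 + k) * (1 - 1 / k) + 1 = k\<^sup>2"
      using k by (simp add: field_simps power2_eq_square)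
    then show ?thesis
      by (metis add_divide_distrib times_divide_eq_left)
  qed
  have off: "(k\<^sup>2 + k) / q * (1 - 1 / (k + 1)) = k\<^sup>2 / q"
  proof -
    have "(k\<^sup>2 + k) * (1 - 1 / (k + 1)) = k\<^sup>2"
      using k by (simp add: field_simps power2_eq_square)
    then show ?thesis
      by (metis times_divide_eq_left)
  qed
  \<comment> \<open>The weights equalise the entries of the mixture on \<open>?V\<close> and off it.\<close>
  have "((k\<^sup>2 + k) / q) *\<^sub>R (1 - y) + (1 / q) *\<^sub>R indicator_vec ?V \<in> capacity_region (del_arc e)"
    using k q by (intro convexD[OF convex_capacity_region y V]) (auto simp: q_def field_simps)
  also have "((k\<^sup>2 + k) / q) *\<^sub>R (1 - y) + (1 / q) *\<^sub>R indicator_vec ?V = (\<chi> v. 1 / (q / k\<^sup>2))"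
    using on off by (simp add: vec_eq_iff y_def indicator_vec_def)
  finally have "broadcast_rate (del_arc e) \<le> q / k\<^sup>2"
    using k q by (intro broadcast_rate_le) auto
  \<comment> \<open>The left side consists of the first three terms of the geometric series in
    \<open>1 / k\<close>, whose sum is the right side.\<close>
  also have "q / k\<^sup>2 < k / (k - 1)"
    using k by (simp add: q_def field_simps power2_eq_square)
  also have "\<dots> \<le> broadcast_rate D"
    using dicycle_le_broadcast_rate[OF loopfree_digraph_axioms dicycle[OF chordless]] unfolding k_def .
  finally show ?thesis
    using assms(2) unfolding critical_arc_def by simp
qed

theorem theorem7:
  fixes D :: "('n::finite, 'b) pre_digraph" and e :: 'b
  assumes "digraph D" and "verts D = UNIV" and "e \<in> arcs D"
    and "(ideal_matrix (dicycle_vertex_incidence D) \<and>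
            (\<exists>C. shortest_chordless_dicycles D = {C} \<and> e \<in> C)) \<or>
         (perfect_digraph D \<and>
            (\<exists>K. largest_cliques D = {K} \<and> e \<in> arcs (D \<restriction> K)))"
  shows "critical_arc D e"
  using assms(4)
proof (elim disjE)
  assume "ideal_matrix (dicycle_vertex_incidence D) \<and>
    (\<exists>C. shortest_chordless_dicycles D = {C} \<and> e \<in> C)"
  then show ?thesis
    using critical_arc_ideal[OF assms(1,3)] by blast
next
  assume "perfect_digraph D \<and> (\<exists>K. largest_cliques D = {K} \<and> e \<in> arcs (D \<restriction> K))"
  then show ?thesis
    using critical_arc_perfect[OF assms(1-3)] by auto
qed

end
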